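(* Let $\kappa>1$ and $\beta>0$, and set $\alpha=L=\lambda=1$, $m=L/\kappa=\kappa^{-1}$ and $s=\kappa^{-1}$. Let $\tau>0$, $\rho=\tau$, and $\omega=\tau^2$, and suppose that $$-4(-\kappa+1)^2\beta^2(-2+\omega)+\omega(\kappa-1+\kappa\omega)^2-4(-\kappa+1)\beta\omega(-3\kappa+1+\kappa\omega)=0.$$ Define the symmetric matrix $$P=\begin{bmatrix} a & b & c\\ b & d & e\\ c & e & f\end{bmatrix}$$ by $$a=-\left(\tfrac{1}{\beta}+2\right)\omega+2(\beta+2)+\tfrac{\beta(s-1)}{\omega}-2(\beta+1)s,$$ $$b=\tfrac12\left((2\beta+1)(s-1)+\omega\right),$$ $$c=\beta-\tfrac{\omega(s+\omega-1)}{2\beta(s-1)}-(\beta+1)s-\omega+1,$$ $$d=(1-s)\beta,\qquad e=\omega-(1-s)\beta,\qquad f=\tfrac{\omega^2}{\beta-\beta s}.$$ Then, with the matrices $\hat A,\hat B,\hat C,\hat D,M$ given in the context (evaluated at these values of $\alpha,\beta,L,m,\rho$), the following linear matrix inequality holds: $$\begin{bmatrix}\hat A^T P\hat A-\tau^2P & \hat A^TP\hat B\\ \hat B^TP\hat A & \hat B^TP\hat B\end{bmatrix}+\lambda\begin{bmatrix}\hat C & \hat D\end{bmatrix}^T M\begin{bmatrix}\hat C & \hat D\end{bmatrix}\preceq 0 .$$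
   Context: For real parameters $\alpha,\beta,L,m,\rho$, with $\kappa=L/m$, define $$\hat A=\begin{bmatrix}\beta+1 & -\beta & 0\\ 1&0&0\\ L(-\beta-1)&\beta L&0\end{bmatrix},\quad \hat B=\begin{bmatrix}-\alpha\\0\\1\end{bmatrix},\quad \hat C=\begin{bmatrix}L(\beta+1)&-L\beta&\rho^2\\ -m(\beta+1)&m\beta&0\end{bmatrix},\quad \hat D=\begin{bmatrix}-1\\1\end{bmatrix},\quad M=\begin{bmatrix}0&1\\1&0\end{bmatrix}.$$ The notation $X\preceq 0$ means that the symmetric matrix $X$ is negative semidefinite. The left-hand side of the linear matrix inequality is a $4\times4$ symmetric matrix, and $[\hat C\ \ \hat D]$ is the $2\times 4$ matrix obtained by horizontal concatenation. *)

theory Defs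
  imports Complex_Main "Jordan_Normal_Form.Matrix"
begin

definition A_hat :: "real \<Rightarrow> real \<Rightarrow> real mat" where
  "A_hat \<beta> L = mat_of_rows_list 3
     [[\<beta> + 1,        - \<beta>,   0],
      [1,            0,     0],
      [L * (- \<beta> - 1), \<beta> * L, 0]]"

definition B_hat :: "real \<Rightarrow> real mat" where
  "B_hat \<alpha> = mat_of_rows_list 1 [[- \<alpha>], [0], [1]]"

definition C_hat :: "real \<Rightarrow> real \<Rightarrow> real \<Rightarrow> real \<Rightarrow> real mat" where
  "C_hat \<beta> L m \<rho> = mat_of_rows_list 3
     [[L * (\<beta> + 1),   - L * \<beta>, \<rho>^2],
      [- m * (\<beta> + 1), m * \<beta>,   0]]"

definition D_hat :: "real mat" where
  "D_hat = mat_of_rows_list 1 [[- 1], [1]]"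

definition M_mat :: "real mat" where
  "M_mat = mat_of_rows_list 2 [[0, 1], [1, 0]]"

text \<open>Horizontal concatenation of matrices with the same number of rows,
  dual to \<^const>\<open>append_rows\<close>.\<close>

definition append_cols :: "'a :: zero mat \<Rightarrow> 'a mat \<Rightarrow> 'a mat" where
  "append_cols A B = four_block_mat A B (0\<^sub>m 0 (dim_col A)) (0\<^sub>m 0 (dim_col B))"

lemma append_cols_carrier [simp, intro]:
  assumes "A \<in> carrier_mat nr nc1" "B \<in> carrier_mat nr nc2"
  shows "append_cols A B \<in> carrier_mat nr (nc1 + nc2)"
  using assms by (simp add: append_cols_def four_block_mat_def Let_def)

lemma index_append_cols:
  assumes "A \<in> carrier_mat nr nc1" "B \<in> carrier_mat nr nc2" "i < nr" "j < nc1 + nc2"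
  shows "append_cols A B $$ (i, j) = (if j < nc1 then A $$ (i, j) else B $$ (i, j - nc1))"
  using assms by (simp add: append_cols_def)

definition neg_semidefinite :: "real mat \<Rightarrow> bool" where
  "neg_semidefinite X \<longleftrightarrow> square_mat X \<and> X\<^sup>T = X \<and>
     (\<forall>v \<in> carrier_vec (dim_row X). v \<bullet> (X *\<^sub>v v) \<le> 0)"

end

theory Submission
  imports Defs
begin

text \<open>
  The matrix of the inequality is not merely negative semidefinite: it is
  \<open>- r r\<^sup>T / (\<omega> u)\<close> for one vector \<open>r\<close>, with \<open>u = (1 - s) \<beta> > 0\<close> and \<open>\<omega> > 0\<close>.
  To find \<open>r\<close>, evaluate the quadratic form at \<open>(x, y, z, w)\<close> and let
  \<open>p = (\<beta> + 1) x - \<beta> y - w\<close>. The vector \<open>[A B] (x, y, z, w)\<close> is then \<open>(p, x, - p)\<close>, and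
  the two rows of \<open>[C D]\<close> give \<open>p + \<omega> z\<close> and \<open>(1 - s) ((\<beta> + 1) x - \<beta> y) - p\<close>, so the form is
  a polynomial in the coordinates \<open>x, y, z, p\<close>. In these coordinates the given entries
  of \<open>P\<close> make the variables \<open>y\<close> and \<open>z\<close> occur only through \<open>u y + \<omega> z\<close>. Completing the
  square in that combination yields
  \<open>- (u p + \<omega> (b x + u y + \<omega> z))\<^sup>2 / (\<omega> u)\<close>
  plus a remainder in \<open>p\<^sup>2\<close>, \<open>p x\<close> and \<open>x\<^sup>2\<close>. The first two remaining coefficients vanish
  by the choice of \<open>P\<close>. The coefficient of \<open>x\<^sup>2\<close> is, up to the factor \<open>4 u\<close>,
  \<open>\<omega> (\<omega> + (1 - s) - 2 u)\<^sup>2 - 8 u (\<omega> - u) (1 - \<omega>)\<close>,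
  and this is the polynomial relating \<open>\<kappa>\<close>, \<open>\<beta>\<close> and \<open>\<omega>\<close>, divided by \<open>\<kappa>\<^sup>2\<close>
  (\<open>rate_curve_reduced\<close>). The rank-one identity is \<open>lmi_matrix_rank_one\<close>.
\<close>

lemma neg_semidefinite_rank_one:
  fixes r :: "nat \<Rightarrow> real"
  assumes "k \<ge> 0"
  shows "neg_semidefinite (mat n n (\<lambda>(i, j). - (k * r i * r j)))"
proof -
  let ?X = "mat n n (\<lambda>(i, j). - (k * r i * r j))"
  have "v \<bullet> (?X *\<^sub>v v) \<le> 0" if v: "v \<in> carrier_vec n" for v
  proof -
    let ?S = "\<Sum>i<n. r i * v $ i"
    have "v \<bullet> (?X *\<^sub>v v) = (\<Sum>i<n. v $ i * (\<Sum>j<n. - (k * r i * r j) * v $ j))"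
      using v by (simp add: scalar_prod_def lessThan_atLeast0)
    also have "\<dots> = - (k * (\<Sum>i<n. \<Sum>j<n. (r i * v $ i) * (r j * v $ j)))"
      by (simp add: sum_distrib_left sum_negf algebra_simps)
    also have "\<dots> = - (k * ?S\<^sup>2)"
      by (simp add: power2_eq_square sum_product)
    finally show ?thesis
      using assms by simp
  qed
  then show ?thesis
    unfolding neg_semidefinite_def by (auto simp: mult_ac)
qed

text \<open>The coefficients of \<open>p\<close> in the variables \<open>x, y, z, w\<close>; this is at once the first row
  of \<open>[A B]\<close>, the negative of its third row, and the first row of \<open>[C D]\<close> up to
  its \<open>z\<close>-entry.\<close>

definition step_coeff :: "real \<Rightarrow> nat \<Rightarrow> real" where
  "step_coeff \<beta> i = [\<beta> + 1, - \<beta>, 0, - 1] ! i"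

definition rest_coeff :: "real \<Rightarrow> real \<Rightarrow> real \<Rightarrow> nat \<Rightarrow> real" where
  "rest_coeff b u \<omega> i = [b, u, \<omega>, 0] ! i"

text \<open>The vector \<open>r\<close>, that is, the linear form \<open>u p + \<omega> (b x + u y + \<omega> z)\<close>.\<close>

definition lmi_factor :: "real \<Rightarrow> real \<Rightarrow> real \<Rightarrow> real \<Rightarrow> nat \<Rightarrow> real" where
  "lmi_factor \<beta> u \<omega> b i = u * step_coeff \<beta> i + \<omega> * rest_coeff b u \<omega> i"

text \<open>The hypotheses on \<open>a, \<dots>, f\<close> are what comparing coefficients with the perfect
  square demands. Written this way the explicit formulas for \<open>a\<close> and \<open>c\<close> stay out of the
  entrywise computation, and the rate condition enters only through \<open>x_x\<close>, the
  coefficient of \<open>x\<^sup>2\<close>.\<close>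

lemma lmi_matrix_rank_one:
  fixes \<beta> s \<tau> \<omega> u a b c d e f :: real
  assumes \<omega>: "\<omega> = \<tau>\<^sup>2" "\<omega> \<noteq> 0"
    and u: "u = (1 - s) * \<beta>" "u \<noteq> 0"
    and step_step: "a - 2 * c + f = 2 - u / \<omega>"
    and x_x: "d - \<omega> * a = - (\<omega> * b\<^sup>2 / u)"
    and b: "2 * b = \<omega> - 2 * u - (1 - s)"
    and c: "c = (1 - s) * (\<beta> + 1) + \<omega> * b / u"
    and def: "d = u" "e = \<omega> - u" "f = \<omega>\<^sup>2 / u"
  defines "P \<equiv> mat_of_rows_list 3 [[a, b, c], [b, d, e], [c, e, f]]"
  shows "four_block_mat
       ((A_hat \<beta> 1)\<^sup>T * P * A_hat \<beta> 1 - \<tau>\<^sup>2 \<cdot>\<^sub>m P) ((A_hat \<beta> 1)\<^sup>T * P * B_hat 1)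
       ((B_hat 1)\<^sup>T * P * A_hat \<beta> 1) ((B_hat 1)\<^sup>T * P * B_hat 1)
     + 1 \<cdot>\<^sub>m ((append_cols (C_hat \<beta> 1 s \<tau>) D_hat)\<^sup>T * M_mat
            * append_cols (C_hat \<beta> 1 s \<tau>) D_hat)
     = mat 4 4 (\<lambda>(i, j). - (1 / (\<omega> * u) * lmi_factor \<beta> u \<omega> b i * lmi_factor \<beta> u \<omega> b j))"
    (is "?F = ?R")
proof (rule eq_matI)
  fix i j :: nat
  assume "i < dim_row ?R" and "j < dim_col ?R"
  then have ij: "i \<in> {0, 1, 2, 3}" "j \<in> {0, 1, 2, 3}"
    by auto
  \<comment> \<open>The linear forms occurring in the quadratic form, as coefficient vectors: \<open>x\<close> and \<open>z\<close>
    are coordinates, and \<open>g\<close> is \<open>(1 - s) (p + w)\<close>, so that the second row of \<open>[C D]\<close>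
    is \<open>g - p\<close>. The matrix \<open>Q\<close> is \<open>P\<close> bordered by zeros.\<close>
  define p l where pl: "p = step_coeff \<beta>" "l = rest_coeff b u \<omega>"
  define x z where xz: "x = (\<lambda>i. [1, 0, 0, 0] ! i :: real)" "z = (\<lambda>i. [0, 0, 1, 0] ! i :: real)"
  define g where g: "g = (\<lambda>i. [(1 - s) * (\<beta> + 1), - u, 0, 0] ! i)"
  define Q where Q: "Q = (\<lambda>i j. [[a, b, c, 0], [b, d, e, 0], [c, e, f, 0], [0, 0, 0, 0]] ! i ! j)"
  have entry: "?F $$ (i, j)
      = (a - 2 * c + f) * p i * p j + (b - e) * (p i * x j + x i * p j) + d * x i * x j
        - \<omega> * Q i j + (p i + \<omega> * z i) * (g j - p j) + (g i - p i) * (p j + \<omega> * z j)"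
    using ij \<omega>(1)
    by (auto simp: P_def A_hat_def B_hat_def C_hat_def D_hat_def M_mat_def append_cols_def
        mat_of_rows_list_def scalar_prod_def numeral_3_eq_3 numeral_2_eq_2 pl step_coeff_def
        xz g Q u(1) four_block_mat_def Let_def algebra_simps)
  \<comment> \<open>Sorted by degree in \<open>p\<close>, the form has three layers. The quadratic one is
    \<open>step_step\<close>; \<open>mixed\<close> identifies the linear form multiplying \<open>p\<close>, and \<open>rest\<close> the part
    free of \<open>p\<close>.\<close>
  have mixed: "(b - e) * x k + g k - \<omega> * z k = - l k" if "k \<in> {0, 1, 2, 3}" for k
    using that b u(1) def
    by (auto simp: pl rest_coeff_def xz g numeral_3_eq_3 numeral_2_eq_2 algebra_simps)
  have rest: "d * x i * x j - \<omega> * Q i j + \<omega> * (z i * g j + g i * z j) = - (\<omega> / u * l i * l j)"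
    using ij u(2) \<omega>(2) x_x unfolding c def
    by (auto simp: pl rest_coeff_def xz g Q numeral_3_eq_3 numeral_2_eq_2 c def field_simps power2_eq_square)
  have "?F $$ (i, j) = - (u / \<omega> * p i * p j)
      + p i * ((b - e) * x j + g j - \<omega> * z j) + ((b - e) * x i + g i - \<omega> * z i) * p j
      + (d * x i * x j - \<omega> * Q i j + \<omega> * (z i * g j + g i * z j))"
    unfolding entry step_step by (simp add: algebra_simps)
  also have "\<dots> = - (u / \<omega> * p i * p j) - p i * l j - l i * p j - \<omega> / u * l i * l j"
    using mixed[OF ij(1)] mixed[OF ij(2)] rest by simp
  also have "\<dots> = - (1 / (\<omega> * u) * (u * p i + \<omega> * l i) * (u * p j + \<omega> * l j))"
    using u(2) \<omega>(2) by (simp add: field_simps)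
  also have "\<dots> = ?R $$ (i, j)"
    using ij by (auto simp: lmi_factor_def pl)
  finally show "?F $$ (i, j) = ?R $$ (i, j)" .
qed (simp_all add: A_hat_def B_hat_def C_hat_def D_hat_def append_cols_def mat_of_rows_list_def)

text \<open>Dividing by \<open>\<kappa>\<^sup>2\<close> turns \<open>\<kappa>\<close> into \<open>s\<close>, and \<open>\<beta>\<close> then occurs only in \<open>u\<close>. Grouping the
  terms into a square exposes the form in which the condition appears when the
  square is completed.\<close>

lemma rate_curve_reduced:
  fixes \<kappa> \<beta> \<omega> s u :: real
  assumes "\<kappa> \<noteq> 0"
    and s: "s = 1 / \<kappa>" and u: "u = (1 - s) * \<beta>"
    and curve: "- 4 * (- \<kappa> + 1)^2 * \<beta>^2 * (- 2 + \<omega>) + \<omega> * (\<kappa> - 1 + \<kappa> * \<omega>)^2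
           - 4 * (- \<kappa> + 1) * \<beta> * \<omega> * (- 3 * \<kappa> + 1 + \<kappa> * \<omega>) = 0"
  shows "\<omega> * (\<omega> + (1 - s) - 2 * u)\<^sup>2 = 8 * u * (\<omega> - u) * (1 - \<omega>)"
proof -
  \<comment> \<open>The given polynomial becomes homogeneous of degree two in \<open>\<kappa>\<close> once each
    constant \<open>1\<close> in it is read as \<open>\<kappa> * s\<close>.\<close>
  have \<kappa>s: "\<kappa> * s = 1"
    using assms by simp
  have "\<kappa>\<^sup>2 * (\<omega> * (\<omega> + (1 - s) - 2 * u)\<^sup>2 - 8 * u * (\<omega> - u) * (1 - \<omega>))
      = - 4 * (- \<kappa> + \<kappa> * s)^2 * \<beta>^2 * (- 2 + \<omega>) + \<omega> * (\<kappa> - \<kappa> * s + \<kappa> * \<omega>)^2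
           - 4 * (- \<kappa> + \<kappa> * s) * \<beta> * \<omega> * (- 3 * \<kappa> + \<kappa> * s + \<kappa> * \<omega>)"
    unfolding u by (simp add: algebra_simps power2_eq_square)
  also have "\<dots> = 0"
    unfolding \<kappa>s by (rule curve)
  finally show ?thesis
    using \<open>\<kappa> \<noteq> 0\<close> by simp
qed

theorem theorem3:
  fixes \<kappa> \<beta> \<alpha> L lam m s \<tau> \<rho> \<omega> a b c d e f :: real
    and P A B C D :: "real mat"
  assumes "\<kappa> > 1" and "\<beta> > 0"
    and "\<alpha> = 1" and "L = 1" and "lam = 1" and "m = L / \<kappa>" and "s = 1 / \<kappa>"
    and "\<tau> > 0" and "\<rho> = \<tau>" and "\<omega> = \<tau>^2"
    and "- 4 * (- \<kappa> + 1)^2 * \<beta>^2 * (- 2 + \<omega>) + \<omega> * (\<kappa> - 1 + \<kappa> * \<omega>)^2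
           - 4 * (- \<kappa> + 1) * \<beta> * \<omega> * (- 3 * \<kappa> + 1 + \<kappa> * \<omega>) = 0"
    and "a = - (1 / \<beta> + 2) * \<omega> + 2 * (\<beta> + 2) + \<beta> * (s - 1) / \<omega> - 2 * (\<beta> + 1) * s"
    and "b = 1 / 2 * ((2 * \<beta> + 1) * (s - 1) + \<omega>)"
    and "c = \<beta> - \<omega> * (s + \<omega> - 1) / (2 * \<beta> * (s - 1)) - (\<beta> + 1) * s - \<omega> + 1"
    and "d = (1 - s) * \<beta>"
    and "e = \<omega> - (1 - s) * \<beta>"
    and "f = \<omega>^2 / (\<beta> - \<beta> * s)"
    and "P = mat_of_rows_list 3 [[a, b, c], [b, d, e], [c, e, f]]"
    and "A = A_hat \<beta> L" and "B = B_hat \<alpha>" and "C = C_hat \<beta> L m \<rho>" and "D = D_hat"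
  shows "neg_semidefinite
    (four_block_mat
       (A\<^sup>T * P * A - \<tau>^2 \<cdot>\<^sub>m P)  (A\<^sup>T * P * B)
       (B\<^sup>T * P * A)              (B\<^sup>T * P * B)
     + lam \<cdot>\<^sub>m ((append_cols C D)\<^sup>T * M_mat * append_cols C D))"
proof -
  define u where u: "u = (1 - s) * \<beta>"
  have s: "s < 1"
    using assms by simp
  have pos: "u > 0" "\<omega> > 0"
    using s assms by (simp_all add: u)
  then have nz: "u \<noteq> 0" "\<omega> \<noteq> 0"
    by auto
  have curve: "\<omega> * (\<omega> + (1 - s) - 2 * u)\<^sup>2 = 8 * u * (\<omega> - u) * (1 - \<omega>)"
    using assms by (intro rate_curve_reduced[of \<kappa>]) (simp_all add: u)
  have beta: "1 / \<beta> = (1 - s) / u"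
    using assms(2) s by (simp add: u)
  have sb: "\<beta> * (s - 1) = - u" "\<beta> - \<beta> * s = u"
    by (simp_all add: u algebra_simps)
  have a: "a = 2 + 2 * u + 2 * (1 - s) - 2 * \<omega> - (1 - s) * \<omega> / u - u / \<omega>"
  proof -
    have "2 * (\<beta> + 1) * s = 2 * \<beta> + 2 * s - 2 * u" by (simp add: u algebra_simps)
    then show ?thesis
      unfolding \<open>a = _\<close> sb beta by (simp add: algebra_simps)
  qed
  have b: "2 * b = \<omega> - 2 * u - (1 - s)"
    unfolding \<open>b = _\<close> by (simp add: u algebra_simps)
  have d: "d = u" "e = \<omega> - u" "f = \<omega>\<^sup>2 / u"
    by (simp_all add: assms(15-17) sb u)
  have c': "c = u + (1 - s) - \<omega> + \<omega> * (\<omega> - (1 - s)) / (2 * u)"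
  proof -
    have *: "2 * \<beta> * (s - 1) = - (2 * u)" "(\<beta> + 1) * s = \<beta> + s - u"
      by (simp_all add: u algebra_simps)
    show ?thesis
      unfolding \<open>c = _\<close> * by (simp add: algebra_simps)
  qed
  \<comment> \<open>This is the condition that \<open>y\<close> and \<open>z\<close> multiply \<open>x\<close> in the ratio \<open>u : \<omega>\<close>.\<close>
  have c: "c = (1 - s) * (\<beta> + 1) + \<omega> * b / u"
  proof -
    have bu: "b = (\<omega> - 2 * u - (1 - s)) / 2" using b by simp
    have *: "(1 - s) * (\<beta> + 1) = u + (1 - s)" by (simp add: u algebra_simps)
    show ?thesis
      unfolding c' bu * using nz by (simp add: field_simps)
  qed
  have step_step: "a - 2 * c + f = 2 - u / \<omega>"
    unfolding a c' d using nz by (simp add: field_simps power2_eq_square)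
  have x_x: "d - \<omega> * a = - (\<omega> * b\<^sup>2 / u)"
  proof -
    have "4 * u * (d - \<omega> * a) + \<omega> * (2 * b)\<^sup>2
        = \<omega> * (\<omega> + (1 - s) - 2 * u)\<^sup>2 - 8 * u * (\<omega> - u) * (1 - \<omega>)"
      unfolding a d b using nz by (simp add: field_simps power2_eq_square)
    also have "\<dots> = 0"
      using curve by simp
    finally show ?thesis
      using nz(1) by (simp add: field_simps power_mult_distrib)
  qed
  have m: "m = s" and \<rho>: "\<rho> = \<tau>"
    using assms by simp_all
  have "neg_semidefinite (mat 4 4 (\<lambda>(i, j).
      - (1 / (\<omega> * u) * lmi_factor \<beta> u \<omega> b i * lmi_factor \<beta> u \<omega> b j)))"
    using pos by (intro neg_semidefinite_rank_one) simp
  then show ?thesis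
    using lmi_matrix_rank_one[OF \<open>\<omega> = \<tau>^2\<close> nz(2) u nz(1) step_step x_x b c d]
    unfolding assms(3-5) m \<rho> assms(18-22) by simp
qed

end
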